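(* Let $V$ be a finite ground set, let $l\ge 1$, and let $f_1,\dots,f_l:2^V\to\mathbb{R}$ be modular functions, $f_i(X)=\sum_{j\in X} f_i(j)$, with $f_i(j)\ge 0$ for all $i$ and all $j\in V$. For $X\subseteq V$ define $$F(X)=\max_{i=1,\dots,l} f_i(X),\qquad \hat F(X)=\sum_{j\in X}\max_{i=1,\dots,l} f_i(j),\qquad \tilde F(X)=\frac1l\sum_{i=1}^l f_i(X).$$ Then for every $X\subseteq V$, $$\hat F(X)\ \ge\ F(X)\ \ge\ \frac1l\,\hat F(X)\qquad\text{and}\qquad \tilde F(X)\ \le\ F(X)\ \le\ l\,\tilde F(X).$$ Moreover, let $\mathcal C\subseteq 2^V$ be a nonempty family of feasible sets. Given a $\beta$-approximation algorithm for minimizing (non-negative) linear cost functions over $\mathcal C$, one obtains an $l\beta$-approximation algorithm for the problem Robust-Min: $\min_{X\in\mathcal C}\max_{i=1,\dots,l} f_i(X)$.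
   Context: For a minimization problem $\min_{X\in\mathcal C} g(X)$ with $g\ge 0$ and a number $\beta\ge 1$, a $\beta$-approximation algorithm is a polynomial-time algorithm that outputs a set $\hat X\in\mathcal C$ with $g(\hat X)\le \beta\min_{X\in\mathcal C} g(X)$. A linear cost function is a function of the form $X\mapsto\sum_{j\in X} c(j)$. Robust-Min is the problem $\min_{X\in\mathcal C}\max_{i} f_i(X)$ with modular non-negative $f_i$. *)

theory Defs
  imports
    Complex_Main
    "HOL-Library.Log_Nat"
    "HOL-Computational_Algebra.Polynomial"
begin

section \<open>Modular functions and the two approximations of their maximum\<close>

definition modular_on :: "'v set \<Rightarrow> ('v set \<Rightarrow> real) \<Rightarrow> bool" where
  "modular_on V g \<longleftrightarrow> (\<forall>X\<subseteq>V. g X = (\<Sum>j\<in>X. g {j}))"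

definition F_max :: "nat \<Rightarrow> (nat \<Rightarrow> 'v set \<Rightarrow> real) \<Rightarrow> 'v set \<Rightarrow> real" where
  "F_max l f X = (MAX i\<in>{1..l}. f i X)"

definition F_hat :: "nat \<Rightarrow> (nat \<Rightarrow> 'v set \<Rightarrow> real) \<Rightarrow> 'v set \<Rightarrow> real" where
  "F_hat l f X = (\<Sum>j\<in>X. MAX i\<in>{1..l}. f i {j})"

definition F_tilde :: "nat \<Rightarrow> (nat \<Rightarrow> 'v set \<Rightarrow> real) \<Rightarrow> 'v set \<Rightarrow> real" where
  "F_tilde l f X = 1 / real l * (\<Sum>i=1..l. f i X)"


section \<open>A random access machine with real and integer cells\<close>

text \<open>
  Programs are structured programs of a random access machine with finitely many index registers, an
  unbounded memory of natural numbers and an unbounded memory of real numbers, both addressed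
  indirectly through the index registers. Index arithmetic is restricted to addition and (truncated)
  subtraction, so that charging one unit per instruction is reasonable; real cells admit the field
  operations and comparisons. The only constants are natural numbers, so rational input yields
  rational cells throughout the computation (see below).
\<close>

record state =
  reg :: "nat \<Rightarrow> nat"
  mem :: "nat \<Rightarrow> nat"
  rmem :: "nat \<Rightarrow> real"

datatype arith = Plus | Minus | Times | Divide

fun arith_op :: "arith \<Rightarrow> real \<Rightarrow> real \<Rightarrow> real" where
  "arith_op Plus x y = x + y"
| "arith_op Minus x y = x - y"
| "arith_op Times x y = x * y"
| "arith_op Divide x y = x / y"

datatype instr =
    SetConst nat nat
  | AddReg nat nat nat
  | SubReg nat nat nat
  | LoadNat nat nat
  | StoreNat nat nat
  | NatToReal nat nat
  | CopyReal nat nat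
  | ArithReal arith nat nat nat

fun step :: "instr \<Rightarrow> state \<Rightarrow> state" where
  "step (SetConst a k) s = s\<lparr>reg := (reg s)(a := k)\<rparr>"
| "step (AddReg a b c) s = s\<lparr>reg := (reg s)(a := reg s b + reg s c)\<rparr>"
| "step (SubReg a b c) s = s\<lparr>reg := (reg s)(a := reg s b - reg s c)\<rparr>"
| "step (LoadNat a b) s = s\<lparr>reg := (reg s)(a := mem s (reg s b))\<rparr>"
| "step (StoreNat a b) s = s\<lparr>mem := (mem s)(reg s a := reg s b)\<rparr>"
| "step (NatToReal a b) s = s\<lparr>rmem := (rmem s)(reg s a := real (reg s b))\<rparr>"
| "step (CopyReal a b) s = s\<lparr>rmem := (rmem s)(reg s a := rmem s (reg s b))\<rparr>"
| "step (ArithReal f a b c) s =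
     s\<lparr>rmem := (rmem s)(reg s a := arith_op f (rmem s (reg s b)) (rmem s (reg s c)))\<rparr>"

text \<open>The addresses, operands and result of an instruction, whose sizes are charged for.\<close>

fun touched :: "instr \<Rightarrow> state \<Rightarrow> real list" where
  "touched (SetConst a k) s = [real k]"
| "touched (AddReg a b c) s = [real (reg s b), real (reg s c), real (reg s b + reg s c)]"
| "touched (SubReg a b c) s = [real (reg s b), real (reg s c), real (reg s b - reg s c)]"
| "touched (LoadNat a b) s = [real (reg s b), real (mem s (reg s b))]"
| "touched (StoreNat a b) s = [real (reg s a), real (reg s b)]"
| "touched (NatToReal a b) s = [real (reg s a), real (reg s b)]"
| "touched (CopyReal a b) s = [real (reg s a), real (reg s b), rmem s (reg s b)]"
| "touched (ArithReal f a b c) s =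
     [real (reg s a), real (reg s b), real (reg s c), rmem s (reg s b), rmem s (reg s c),
      arith_op f (rmem s (reg s b)) (rmem s (reg s c))]"

datatype test = LessReg nat nat | LessReal nat nat | Neg test

fun holds :: "test \<Rightarrow> state \<Rightarrow> bool" where
  "holds (LessReg a b) s \<longleftrightarrow> reg s a < reg s b"
| "holds (LessReal a b) s \<longleftrightarrow> rmem s (reg s a) < rmem s (reg s b)"
| "holds (Neg e) s \<longleftrightarrow> \<not> holds e s"

fun test_touched :: "test \<Rightarrow> state \<Rightarrow> real list" where
  "test_touched (LessReg a b) s = [real (reg s a), real (reg s b)]"
| "test_touched (LessReal a b) s =
     [real (reg s a), real (reg s b), rmem s (reg s a), rmem s (reg s b)]"
| "test_touched (Neg e) s = test_touched e s"

datatype prog =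
    Instr instr
  | Seq prog prog
  | Cond test prog prog
  | While test prog

text \<open>
  \<open>sz x\<close> is the surcharge for handling the number \<open>x\<close>, on top of one unit per instruction or test,
  and likewise on top of one unit per input item.
\<close>

definition charge :: "(real \<Rightarrow> nat) \<Rightarrow> real list \<Rightarrow> nat" where
  "charge sz xs = 1 + (\<Sum>x\<leftarrow>xs. sz x)"

text \<open>\<open>exec sz p s t s'\<close>: from state \<open>s\<close>, program \<open>p\<close> halts in state \<open>s'\<close> after time \<open>t\<close>.\<close>

inductive exec :: "(real \<Rightarrow> nat) \<Rightarrow> prog \<Rightarrow> state \<Rightarrow> nat \<Rightarrow> state \<Rightarrow> bool"
  for sz :: "real \<Rightarrow> nat" where
  Instr: "exec sz (Instr i) s (charge sz (touched i s)) (step i s)"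
| Seq: "exec sz p s t s' \<Longrightarrow> exec sz q s' u s'' \<Longrightarrow> exec sz (Seq p q) s (t + u) s''"
| CondTrue: "holds e s \<Longrightarrow> exec sz p s t s' \<Longrightarrow>
    exec sz (Cond e p q) s (charge sz (test_touched e s) + t) s'"
| CondFalse: "\<not> holds e s \<Longrightarrow> exec sz q s t s' \<Longrightarrow>
    exec sz (Cond e p q) s (charge sz (test_touched e s) + t) s'"
| WhileFalse: "\<not> holds e s \<Longrightarrow> exec sz (While e p) s (charge sz (test_touched e s)) s"
| WhileTrue: "holds e s \<Longrightarrow> exec sz p s t s' \<Longrightarrow> exec sz (While e p) s' u s'' \<Longrightarrow>
    exec sz (While e p) s (charge sz (test_touched e s) + t + u) s''"

lemma exec_deterministic:
  "exec sz p s t s' \<Longrightarrow> exec sz p s u s'' \<Longrightarrow> t = u \<and> s' = s''"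
proof (induction arbitrary: u s'' rule: exec.induct)
  case (Instr i s)
  then show ?case by (auto elim: exec.cases)
next
  case (Seq p s t s1 q v s2)
  from Seq.prems show ?case
    by (cases rule: exec.cases) (use Seq.IH in blast)+
next
  case (CondTrue e s p t s1 q)
  from CondTrue.prems show ?case
    by (cases rule: exec.cases) (use CondTrue.IH CondTrue.hyps in blast)+
next
  case (CondFalse e s q t s1 p)
  from CondFalse.prems show ?case
    by (cases rule: exec.cases) (use CondFalse.IH CondFalse.hyps in blast)+
next
  case (WhileFalse e s p)
  from WhileFalse.prems show ?case
    by (cases rule: exec.cases) (use WhileFalse.hyps in blast)+
next
  case (WhileTrue e s p t s1 v s2)
  from WhileTrue.prems show ?case
    by (cases rule: exec.cases) (use WhileTrue.IH WhileTrue.hyps in blast)+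
qed

lemma exec_rational:
  "exec sz p s t s' \<Longrightarrow> range (rmem s) \<subseteq> \<rat> \<Longrightarrow> range (rmem s') \<subseteq> \<rat>"
proof (induction rule: exec.induct)
  case (Instr i s)
  show ?case
  proof (cases i)
    case (ArithReal f a b c)
    then show ?thesis using Instr by (cases f) (auto simp: image_subset_iff)
  qed (use Instr in \<open>auto simp: image_subset_iff\<close>)
qed auto

text \<open>
  The two standard notions of time for combinatorial optimization, each with its set of admissible
  input numbers: unit cost on real data (real RAM), and bit cost on rational data (logarithmic cost
  RAM, polynomially equivalent to Turing machines). A rational counts with the binary lengths of
  numerator and denominator in lowest terms; \<open>bit_size\<close> has no meaning on irrational numbers.
\<close>

definition bit_size :: "real \<Rightarrow> nat" where
  "bit_size x = (case quotient_of (inv real_of_rat x) of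
     (p, q) \<Rightarrow> floorlog 2 (nat \<bar>p\<bar>) + floorlog 2 (nat q))"

definition cost_models :: "(real set \<times> (real \<Rightarrow> nat)) set" where
  "cost_models = {(UNIV, \<lambda>_. 0), (\<rat>, bit_size)}"


section \<open>Minimization problems and approximation algorithms\<close>

text \<open>
  A minimization problem is a class of instances \<open>p\<close>, each with a ground set (enumerated by the list
  \<open>ground p\<close>), a feasible family, an objective, and an encoding as input: a list of parameters
  passed in the first registers, a list of natural numbers and a list of real numbers.
\<close>

record ('p, 'v) min_problem =
  insts :: "'p set"
  ground :: "'p \<Rightarrow> 'v list"
  feas :: "'p \<Rightarrow> 'v set set"
  objective :: "'p \<Rightarrow> 'v set \<Rightarrow> real"
  in_regs :: "'p \<Rightarrow> nat list"
  in_nats :: "'p \<Rightarrow> nat list"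
  in_reals :: "'p \<Rightarrow> real list"

definition load :: "'a::zero list \<Rightarrow> nat \<Rightarrow> 'a" where
  "load xs k = (if k < length xs then xs ! k else 0)"

definition init :: "('p, 'v) min_problem \<Rightarrow> 'p \<Rightarrow> state" where
  "init P p = \<lparr>reg = load (in_regs P p), mem = load (in_nats P p), rmem = load (in_reals P p)\<rparr>"

definition input_size :: "(real \<Rightarrow> nat) \<Rightarrow> ('p, 'v) min_problem \<Rightarrow> 'p \<Rightarrow> nat" where
  "input_size sz P p =
     (\<Sum>x\<leftarrow>map real (in_regs P p) @ map real (in_nats P p) @ in_reals P p. 1 + sz x)"

text \<open>The output is read off as a characteristic vector in the natural number memory.\<close>

definition output_set :: "('p, 'v) min_problem \<Rightarrow> 'p \<Rightarrow> state \<Rightarrow> 'v set" where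
  "output_set P p s = {ground P p ! j | j. j < length (ground P p) \<and> mem s j \<noteq> 0}"

definition polynomial_time :: "(real \<Rightarrow> nat) \<Rightarrow> ('p, 'v) min_problem \<Rightarrow> prog \<Rightarrow> bool" where
  "polynomial_time sz P A \<longleftrightarrow>
     (\<exists>b :: nat poly. \<forall>p\<in>insts P. \<exists>t s.
        exec sz A (init P p) t s \<and> t \<le> poly b (input_size sz P p))"

text \<open>The ratio \<open>\<rho>\<close> may depend on the instance, as it does for the ratio \<open>l * \<beta>\<close>.\<close>

definition approximation_algorithm ::
  "(real \<Rightarrow> nat) \<Rightarrow> ('p, 'v) min_problem \<Rightarrow> ('p \<Rightarrow> real) \<Rightarrow> prog \<Rightarrow> bool" where
  "approximation_algorithm sz P \<rho> A \<longleftrightarrow>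
     polynomial_time sz P A \<and>
     (\<forall>p\<in>insts P. \<forall>t s. exec sz A (init P p) t s \<longrightarrow>
        output_set P p s \<in> feas P p \<and>
        objective P p (output_set P p s) \<le> \<rho> p * Min (objective P p ` feas P p))"


section \<open>Linear and robust minimization over a feasible family\<close>

text \<open>
  Polynomial time refers to the ground set and the feasible family as part of the input, for
  instance to the family of spanning trees of an input graph. Hence a feasible family is given
  uniformly for a class of structures \<open>x\<close>: each has a ground set, enumerated by \<open>elems x\<close>, a
  family \<open>family x\<close> of subsets of it, and an arbitrary description \<open>code x\<close> available to algorithms.
\<close>

record ('x, 'v) feasibility =
  structs :: "'x set"
  elems :: "'x \<Rightarrow> 'v list"
  family :: "'x \<Rightarrow> 'v set set"
  code :: "'x \<Rightarrow> nat list"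

definition valid_feasibility :: "('x, 'v) feasibility \<Rightarrow> bool" where
  "valid_feasibility K \<longleftrightarrow>
     (\<forall>x\<in>structs K. distinct (elems K x) \<and> family K x \<noteq> {} \<and> family K x \<subseteq> Pow (set (elems K x)))"

definition linear_min ::
  "real set \<Rightarrow> ('x, 'v) feasibility \<Rightarrow> ('x \<times> ('v \<Rightarrow> real), 'v) min_problem" where
  "linear_min D K = \<lparr>
     insts = {(x, c). x \<in> structs K \<and> (\<forall>j\<in>set (elems K x). c j \<in> D \<and> c j \<ge> 0)},
     ground = (\<lambda>(x, c). elems K x),
     feas = (\<lambda>(x, c). family K x),
     objective = (\<lambda>(x, c) X. \<Sum>j\<in>X. c j),
     in_regs = (\<lambda>(x, c). [length (elems K x), length (code K x)]),
     in_nats = (\<lambda>(x, c). code K x),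
     in_reals = (\<lambda>(x, c). map c (elems K x))\<rparr>"

definition robust_min ::
  "real set \<Rightarrow> ('x, 'v) feasibility \<Rightarrow> ('x \<times> nat \<times> (nat \<Rightarrow> 'v set \<Rightarrow> real), 'v) min_problem" where
  "robust_min D K = \<lparr>
     insts = {(x, l, f). x \<in> structs K \<and> l \<ge> 1 \<and>
       (\<forall>i\<in>{1..l}. modular_on (set (elems K x)) (f i) \<and>
          (\<forall>j\<in>set (elems K x). f i {j} \<in> D \<and> f i {j} \<ge> 0))},
     ground = (\<lambda>(x, l, f). elems K x),
     feas = (\<lambda>(x, l, f). family K x),
     objective = (\<lambda>(x, l, f). F_max l f),
     in_regs = (\<lambda>(x, l, f). [length (elems K x), length (code K x), l]),
     in_nats = (\<lambda>(x, l, f). code K x),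
     in_reals = (\<lambda>(x, l, f). concat (map (\<lambda>i. map (\<lambda>j. f i {j}) (elems K x)) [1..<Suc l]))\<rparr>"

end

theory Submission
  imports Defs
begin

text \<open>
  The algorithm for the robust problem hands the costs \<open>c(j) = max\<^sub>i f\<^sub>i(j)\<close> to the given
  algorithm for linear costs. Since \<open>F \<le> F_hat \<le> l F\<close>, its output \<open>X\<close> satisfies
  \<open>F(X) \<le> F_hat(X) \<le> \<beta> F_hat(Y) \<le> l \<beta> F(Y)\<close> for every feasible \<open>Y\<close>.

  On the machine, the input consists of \<open>l\<close> rows of length \<open>n\<close>. Running down from the last cell,
  each cell is merged into the one \<open>n\<close> places before it and then erased. Merging preserves the
  maximum of every column because all entries are non-negative, so in the end the first row holds
  the maxima and all other cells are zero, as in a fresh input for the linear problem.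
\<close>

section \<open>The two approximations\<close>

text \<open>Apart from the termwise comparison \<open>F_max \<le> F_hat\<close>, everything is
  compared with the total \<open>\<Sum>i=1..l. f i X\<close>. Its terms are non-negative and bounded
  by their maximum, so it lies between \<open>F_max l f X\<close> and
  \<open>real l * F_max l f X\<close>. It dominates \<open>F_hat l f X\<close>, since the maximum
  over \<open>i\<close> of the non-negative \<open>f i {j}\<close> is at most their sum.\<close>

lemma F_max_F_hat_F_tilde:
  assumes "l \<ge> 1"
    and modular: "\<And>i. i \<in> {1..l} \<Longrightarrow> modular_on V (f i)"
    and nonneg: "\<And>i j. i \<in> {1..l} \<Longrightarrow> j \<in> V \<Longrightarrow> f i {j} \<ge> 0"
    and "X \<subseteq> V"
  shows "F_max l f X \<le> F_hat l f X" and "1 / real l * F_hat l f X \<le> F_max l f X"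
    and "F_tilde l f X \<le> F_max l f X" and "F_max l f X \<le> real l * F_tilde l f X"
proof -
  have ne: "{1..l} \<noteq> {}" using \<open>l \<ge> 1\<close> by auto
  have f: "f i X = (\<Sum>j\<in>X. f i {j})" if "i \<in> {1..l}" for i
    using modular[OF that] \<open>X \<subseteq> V\<close> by (simp add: modular_on_def)
  have f_nonneg: "f i X \<ge> 0" if "i \<in> {1..l}" for i
    using f[OF that] nonneg[OF that] \<open>X \<subseteq> V\<close> by (auto intro!: sum_nonneg)
  have le_max: "f i X \<le> F_max l f X" if "i \<in> {1..l}" for i
    unfolding F_max_def using that by (intro Max_ge) auto
  have "f i X \<le> F_hat l f X" if "i \<in> {1..l}" for i
    unfolding F_hat_def f[OF that] using that by (intro sum_mono Max_ge) auto
  then show "F_max l f X \<le> F_hat l f X"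
    unfolding F_max_def using ne by (subst Max_le_iff) auto
  have total: "(\<Sum>i=1..l. f i X) \<le> real l * F_max l f X"
    using sum_bounded_above[of "{1..l}" "\<lambda>i. f i X", OF le_max] by simp
  then show "F_tilde l f X \<le> F_max l f X"
    unfolding F_tilde_def using \<open>l \<ge> 1\<close> by (simp add: field_simps)
  have "F_hat l f X \<le> (\<Sum>j\<in>X. \<Sum>i=1..l. f i {j})"
    unfolding F_hat_def
  proof (intro sum_mono)
    fix j assume "j \<in> X"
    then have "f i {j} \<le> (\<Sum>i=1..l. f i {j})" if "i \<in> {1..l}" for i
      using that nonneg \<open>X \<subseteq> V\<close> by (intro member_le_sum) auto
    then show "(MAX i\<in>{1..l}. f i {j}) \<le> (\<Sum>i=1..l. f i {j})"
      using ne by (subst Max_le_iff) auto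
  qed
  also have "\<dots> = (\<Sum>i=1..l. f i X)"
    by (subst sum.swap) (simp add: f)
  finally show "1 / real l * F_hat l f X \<le> F_max l f X"
    using total \<open>l \<ge> 1\<close> by (simp add: field_simps)
  have "f i X \<le> (\<Sum>i=1..l. f i X)" if "i \<in> {1..l}" for i
    using that f_nonneg by (intro member_le_sum) auto
  then have "F_max l f X \<le> (\<Sum>i=1..l. f i X)"
    unfolding F_max_def using ne by (subst Max_le_iff) auto
  then show "F_max l f X \<le> real l * F_tilde l f X"
    unfolding F_tilde_def using \<open>l \<ge> 1\<close> by simp
qed


section \<open>Timed execution\<close>

text \<open>
  Time is counted in units of \<open>1 + 6 M\<close>, the largest possible charge of an instruction or test
  that only touches numbers of size at most \<open>M\<close>.
\<close>

definition runs ::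
  "(real \<Rightarrow> nat) \<Rightarrow> nat \<Rightarrow> prog \<Rightarrow> state \<Rightarrow> nat \<Rightarrow> (state \<Rightarrow> bool) \<Rightarrow> bool" where
  "runs sz M p s k Q \<longleftrightarrow> (\<exists>t s'. exec sz p s t s' \<and> t \<le> k * (1 + 6 * M) \<and> Q s')"

lemma charge_le:
  assumes "length xs \<le> 6" and "\<forall>x\<in>set xs. sz x \<le> M"
  shows "charge sz xs \<le> 1 + 6 * M"
proof -
  have "(\<Sum>x\<leftarrow>xs. sz x) \<le> (\<Sum>x\<leftarrow>xs. M)"
    using assms(2) by (intro sum_list_mono) auto
  also have "\<dots> \<le> 6 * M"
    using assms(1) by (simp add: sum_list_triv)
  finally show ?thesis by (simp add: charge_def)
qed

lemma charge_touched_le: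
  "\<forall>x\<in>set (touched i s). sz x \<le> M \<Longrightarrow> charge sz (touched i s) \<le> 1 + 6 * M"
  by (rule charge_le) (cases i; simp)+

lemma length_test_touched: "length (test_touched e s) \<le> 6"
  by (induction e) auto

lemma charge_test_touched_le:
  "\<forall>x\<in>set (test_touched e s). sz x \<le> M \<Longrightarrow> charge sz (test_touched e s) \<le> 1 + 6 * M"
  by (rule charge_le[OF length_test_touched])

lemma runs_weaken:
  assumes "runs sz M p s k Q" and "k \<le> k'" and "\<And>s'. Q s' \<Longrightarrow> Q' s'"
  shows "runs sz M p s k' Q'"
proof -
  have "k * (1 + 6 * M) \<le> k' * (1 + 6 * M)" using assms(2) by (rule mult_le_mono1)
  then show ?thesis using assms(1,3) unfolding runs_def by (meson order_trans)
qed

lemma runs_Instr: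
  assumes "\<forall>x\<in>set (touched i s). sz x \<le> M" and "Q (step i s)"
  shows "runs sz M (Instr i) s 1 Q"
  using exec.Instr charge_touched_le[OF assms(1)] assms(2) unfolding runs_def
  by (metis mult_1)

text \<open>The run of \<open>q\<close> stands in the postcondition of \<open>p\<close>, so that a
  sequence splits by \<open>intro\<close> while the budgets add up.\<close>

lemma runs_Seq:
  assumes "runs sz M p s k (\<lambda>s'. runs sz M q s' k' Q)"
  shows "runs sz M (Seq p q) s (k + k') Q"
proof -
  obtain t s' where p: "exec sz p s t s'" "t \<le> k * (1 + 6 * M)" and "runs sz M q s' k' Q"
    using assms unfolding runs_def by blast
  then obtain u s'' where q: "exec sz q s' u s''" "u \<le> k' * (1 + 6 * M)" "Q s''"
    unfolding runs_def by blast
  have "t + u \<le> (k + k') * (1 + 6 * M)"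
    using add_mono[OF p(2) q(2)] by (simp only: distrib_right)
  then show ?thesis
    unfolding runs_def using exec.Seq[OF p(1) q(1)] q(3) by blast
qed

lemma runs_Cond:
  assumes test: "\<forall>x\<in>set (test_touched e s). sz x \<le> M"
    and "holds e s \<Longrightarrow> runs sz M p s k Q" and "\<not> holds e s \<Longrightarrow> runs sz M q s k Q"
  shows "runs sz M (Cond e p q) s (1 + k) Q"
proof -
  have le: "charge sz (test_touched e s) + t \<le> (1 + k) * (1 + 6 * M)" if "t \<le> k * (1 + 6 * M)" for t
    using add_mono[OF charge_test_touched_le[of e s sz M, OF test] that]
    by (simp only: distrib_right mult_1)
  show ?thesis
  proof (cases "holds e s")
    case True
    then show ?thesis using assms(2) le exec.CondTrue unfolding runs_def by metis
  next
    case False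
    then show ?thesis using assms(3) le exec.CondFalse unfolding runs_def by metis
  qed
qed

text \<open>The measure \<open>\<mu>\<close> bounds the number of rounds. Each round pays one unit
  for the test and \<open>k\<close> for the body; the leading unit pays for the test that ends the
  loop.\<close>

lemma runs_While:
  assumes test: "\<And>s. I s \<Longrightarrow> \<forall>x\<in>set (test_touched e s). sz x \<le> M"
    and body: "\<And>s. I s \<Longrightarrow> holds e s \<Longrightarrow> runs sz M p s k (\<lambda>s'. I s' \<and> \<mu> s' < \<mu> s)"
    and "I s"
  shows "runs sz M (While e p) s (1 + \<mu> s * (1 + k)) (\<lambda>s'. I s' \<and> \<not> holds e s')"
  using \<open>I s\<close>
proof (induction "\<mu> s" arbitrary: s rule: less_induct)
  case less
  let ?C = "1 + 6 * M"
  have charge: "charge sz (test_touched e s) \<le> ?C"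
    using charge_test_touched_le test less.prems by blast
  show ?case
  proof (cases "holds e s")
    case True
    obtain t s' where p: "exec sz p s t s'" "t \<le> k * ?C" "I s'" "\<mu> s' < \<mu> s"
      using body[OF less.prems True] unfolding runs_def by blast
    obtain u s'' where q: "exec sz (While e p) s' u s''" "u \<le> (1 + \<mu> s' * (1 + k)) * ?C"
        "I s''" "\<not> holds e s''"
      using less.hyps[OF p(4,3)] unfolding runs_def by blast
    have "charge sz (test_touched e s) + t + u \<le> (1 + k + (1 + \<mu> s' * (1 + k))) * ?C"
      using add_mono[OF add_mono[OF charge p(2)] q(2)] by (simp only: distrib_right mult_1)
    also have "1 + k + (1 + \<mu> s' * (1 + k)) = 1 + Suc (\<mu> s') * (1 + k)"
      by simp
    also have "\<dots> * ?C \<le> (1 + \<mu> s * (1 + k)) * ?C"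
      using p(4) by (intro mult_le_mono1 add_left_mono) (simp only: Suc_le_eq)
    finally show ?thesis
      unfolding runs_def using exec.WhileTrue[OF True p(1) q(1)] q(3,4) by blast
  next
    case False
    have "?C \<le> (1 + \<mu> s * (1 + k)) * ?C" by simp
    then show ?thesis
      using exec.WhileFalse[OF False] charge less.prems False unfolding runs_def
      by (meson order_trans)
  qed
qed


section \<open>Replacing the rows by their maximum\<close>

text \<open>
  Registers 0 and 1 hold the lengths of a row and of the code, and register 2 the number of rows.
  Register 3 points to the cell being erased, register 4 to the one it is merged into, register 5
  holds 1 and register 6 holds 0. Computing the end of the last row is skipped for empty rows: their
  number is not polynomial in the size of the input.
\<close>

definition last_row_end :: prog where
  "last_row_end =
     Seq (Instr (SetConst 5 1))
       (Cond (LessReg 6 0)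
         (While (LessReg 6 2) (Seq (Instr (AddReg 3 3 0)) (Instr (SubReg 2 2 5))))
         (Instr (SetConst 2 0)))"

text \<open>The loop stops at the first row, whose cells are kept. The else branch is a no-op, as
  register 6 already holds 0; the same 0 erases the merged cell.\<close>

definition merge_cells :: prog where
  "merge_cells =
     While (LessReg 0 3)
       (Seq (Instr (SubReg 3 3 5))
       (Seq (Instr (SubReg 4 3 0))
       (Seq (Cond (LessReal 4 3) (Instr (CopyReal 4 3)) (Instr (SetConst 6 0)))
            (Instr (NatToReal 3 6)))))"

text \<open>The given algorithm is specified only on fresh inputs of the linear problem, where every
  register from 2 on is 0. Registers 2 and 6 are already 0 at this point.\<close>

definition clear_registers :: prog where
  "clear_registers =
     Seq (Instr (SetConst 3 0)) (Seq (Instr (SetConst 4 0)) (Instr (SetConst 5 0)))"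

definition row_maximum :: prog where
  "row_maximum = Seq last_row_end (Seq merge_cells clear_registers)"

text \<open>The invariant of the merging loop. Cells are laid out row by row, so a column is a
  residue class modulo \<open>n\<close>. The index \<open>k\<close> also ranges over the zeros
  behind the input; they do no harm because all values are non-negative.\<close>

definition column_maxima :: "nat \<Rightarrow> (nat \<Rightarrow> real) \<Rightarrow> (nat \<Rightarrow> real) \<Rightarrow> bool" where
  "column_maxima n c v \<longleftrightarrow> (\<forall>k. 0 \<le> v k) \<and>
     (\<forall>j<n. (\<forall>k. k mod n = j \<longrightarrow> v k \<le> c j) \<and> (\<exists>k. k mod n = j \<and> v k = c j))"

text \<open>The cells \<open>p\<close> and \<open>p - n\<close> share a column. If either attained
  the maximum, then \<open>p - n\<close> does so afterwards; any other witness is untouched. The new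
  0 stays below the bound because the old non-negative value did.\<close>

lemma column_maxima_merge:
  assumes cm: "column_maxima n c v" and "0 < n" and "n \<le> p"
  shows "column_maxima n c (v(p - n := max (v (p - n)) (v p), p := 0))"
    (is "column_maxima n c ?w")
proof -
  have mod: "(p - n) mod n = p mod n" and neq: "p - n \<noteq> p"
    using assms(2,3) by (simp_all add: le_mod_geq)
  have nonneg: "0 \<le> v k" for k using cm by (simp add: column_maxima_def)
  have upper: "v k \<le> c (k mod n)" for k
    using cm \<open>0 < n\<close> by (auto simp: column_maxima_def)
  have "?w k \<le> c (k mod n)" for k
    using upper[of k] upper[of "p - n"] upper[of p] nonneg[of p] mod by auto
  moreover have "\<exists>k. k mod n = j \<and> ?w k = c j" if "j < n" for j
  proof -
    obtain k where k: "k mod n = j" "v k = c j"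
      using cm \<open>j < n\<close> unfolding column_maxima_def by blast
    have "?w (p - n) = c j" if "k = p \<or> k = p - n"
      using that k upper[of p] upper[of "p - n"] mod neq by auto
    moreover have "?w k = c j" if "k \<noteq> p" "k \<noteq> p - n"
      using that k by simp
    ultimately show ?thesis using k(1) mod by metis
  qed
  moreover have "0 \<le> ?w k" for k
    using nonneg by (simp add: le_max_iff_disj)
  ultimately show ?thesis
    unfolding column_maxima_def by blast
qed

text \<open>If the column maximum is attained beyond the first row, it is 0, and then the entry of
  the first row is squeezed between 0 and 0.\<close>

lemma column_maxima_first_row:
  assumes cm: "column_maxima n c v" and zero: "\<And>k. n \<le> k \<Longrightarrow> v k = 0" and "j < n"
  shows "v j = c j"
proof -
  obtain k where k: "k mod n = j" "v k = c j"
    using cm \<open>j < n\<close> unfolding column_maxima_def by blast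
  have "0 \<le> v j" "v j \<le> c j"
    using cm \<open>j < n\<close> by (simp_all add: column_maxima_def)
  then show ?thesis using k zero[of k] by (cases "k < n") auto
qed

section \<open>Correctness and running time of the row maximum program\<close>

lemma runs_last_row_end:
  assumes sz: "\<And>k. k \<le> N \<Longrightarrow> sz (real k) \<le> M" and N: "1 \<le> N" "n * l \<le> N" and "1 \<le> l"
    and s: "reg s = load [n, m, l]"
  shows "runs sz M last_row_end s (3 + 3 * N)
    (\<lambda>s'. s' = s\<lparr>reg := (load [n, m])(3 := n * l, 5 := 1)\<rparr>)"
proof -
  \<comment> \<open>Registers cannot be multiplied, so \<open>n * l\<close> is built by repeated
    addition; \<open>i\<close> is the number of rows still to be added.\<close>
  define I where "I s' \<longleftrightarrow> (\<exists>i\<le>l. s' = s\<lparr>reg := (load [n, m])(2 := i, 3 := n * (l - i), 5 := 1)\<rparr>)"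
    for s'
  have load: "load [n, m] 0 = n" "load [n, m] 2 = 0" "load [n, m] 6 = 0"
    "load [n, m, l] 0 = n" "load [n, m, l] 6 = 0"
    by (simp_all add: load_def)
  have start: "(load [n, m, l])(5 := 1) = (load [n, m])(2 := l, 3 := 0, 5 := 1)"
    by (auto simp: load_def fun_eq_iff less_Suc_eq numeral_2_eq_2)
  have "n \<le> N" using N(2) \<open>1 \<le> l\<close> by (metis mult.comm_neutral mult_le_mono2 order_trans)
  have loop: "runs sz M (While (LessReg 6 2) (Seq (Instr (AddReg 3 3 0)) (Instr (SubReg 2 2 5))))
      (s\<lparr>reg := (load [n, m, l])(5 := 1)\<rparr>) (1 + l * (1 + (1 + 1)))
      (\<lambda>s'. s' = s\<lparr>reg := (load [n, m])(3 := n * l, 5 := 1)\<rparr>)" if "0 < n"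
  proof -
    \<comment> \<open>For non-empty rows, \<open>l \<le> n * l \<le> N\<close> bounds the number of
      rounds. For \<open>n = 0\<close> there is no such bound on \<open>l\<close>.\<close>
    have "i \<le> N" if "i \<le> l" for i
      using that N(2) \<open>0 < n\<close> by (cases n) auto
    note le = this
    have nle: "n * i \<le> N" if "i \<le> l" for i
      using that N(2) by (meson mult_le_mono2 order_trans)
    have "runs sz M (While (LessReg 6 2) (Seq (Instr (AddReg 3 3 0)) (Instr (SubReg 2 2 5))))
      (s\<lparr>reg := (load [n, m, l])(5 := 1)\<rparr>)
      (1 + reg (s\<lparr>reg := (load [n, m, l])(5 := 1)\<rparr>) 2 * (1 + (1 + 1)))
      (\<lambda>s'. I s' \<and> \<not> holds (LessReg 6 2) s')"
    proof (rule runs_While)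
      show "I (s\<lparr>reg := (load [n, m, l])(5 := 1)\<rparr>)"
        unfolding I_def start by (intro exI[of _ l]) simp
    next
      fix s' assume "I s'"
      then show "\<forall>x\<in>set (test_touched (LessReg 6 2) s'). sz x \<le> M"
        using sz le sz[of 0] by (auto simp: I_def load)
    next
      fix s' assume "I s'" "holds (LessReg 6 2) s'"
      then obtain i where i: "i \<le> l" "0 < i"
        and s': "s' = s\<lparr>reg := (load [n, m])(2 := i, 3 := n * (l - i), 5 := 1)\<rparr>"
        by (auto simp: I_def load)
      have eq: "n * (l - i) + n = n * (l - (i - 1))"
      proof -
        have "l - (i - 1) = Suc (l - i)" using i by simp
        then show ?thesis by simp
      qed
      let ?s = "s\<lparr>reg := (load [n, m])(2 := i - 1, 3 := n * (l - (i - 1)), 5 := 1)\<rparr>"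
      have step2: "step (SubReg 2 2 5) (step (AddReg 3 3 0) s') = ?s"
        using eq by (simp add: s' load fun_eq_iff)
      have "I ?s"
        unfolding I_def using i by (intro exI[of _ "i - 1"]) simp
      have szs: "sz (real (n * (l - i))) \<le> M" "sz (real (n * (l - (i - 1)))) \<le> M"
          "sz (real n) \<le> M" "sz (real i) \<le> M" "sz (real 1) \<le> M" "sz (real (i - 1)) \<le> M"
        by (rule sz; use i(1) le[of i] nle[of "l - i"] nle[of "l - (i - 1)"] \<open>n \<le> N\<close> N(1) in simp)+
      show "runs sz M (Seq (Instr (AddReg 3 3 0)) (Instr (SubReg 2 2 5))) s' (1 + 1)
          (\<lambda>t. I t \<and> reg t 2 < reg s' 2)"
      proof (intro runs_Seq runs_Instr, unfold step2)
        show "\<forall>x\<in>set (touched (AddReg 3 3 0) s'). sz x \<le> M"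
          using szs by (simp add: s' load eq del: of_nat_mult of_nat_add of_nat_diff)
        show "\<forall>x\<in>set (touched (SubReg 2 2 5) (step (AddReg 3 3 0) s')). sz x \<le> M"
          using szs by (simp add: s' del: of_nat_diff)
        show "I ?s \<and> reg ?s 2 < reg s' 2"
          using \<open>I ?s\<close> i(2) by (simp add: s')
      qed
    qed
    then show ?thesis
    proof (rule runs_weaken)
      fix s' assume "I s' \<and> \<not> holds (LessReg 6 2) s'"
      then obtain i where "s' = s\<lparr>reg := (load [n, m])(2 := i, 3 := n * (l - i), 5 := 1)\<rparr>" "i = 0"
        unfolding I_def by (auto simp: load)
      then show "s' = s\<lparr>reg := (load [n, m])(3 := n * l, 5 := 1)\<rparr>"
        by (simp add: fun_upd_idem[of "load [n, m]", OF load(2)])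
    qed (simp add: load_def)
  qed
  have empty: "(load [n, m, l])(5 := 1, 2 := 0) = (load [n, m])(3 := n * l, 5 := 1)" if "n = 0"
    using that by (auto simp: load_def fun_eq_iff less_Suc_eq numeral_2_eq_2)
  have "l \<le> N \<or> n = 0" using N(2) by (cases n) auto
  have "runs sz M last_row_end s (1 + (1 + (1 + 3 * N)))
    (\<lambda>s'. s' = s\<lparr>reg := (load [n, m])(3 := n * l, 5 := 1)\<rparr>)"
    unfolding last_row_end_def
  proof (intro runs_Seq runs_Instr runs_Cond)
    show "\<forall>x\<in>set (touched (SetConst 5 1) s). sz x \<le> M"
      using sz[OF N(1)] by simp
    show "\<forall>x\<in>set (test_touched (LessReg 6 0) (step (SetConst 5 1) s)). sz x \<le> M"
      using sz[OF \<open>n \<le> N\<close>] sz[of 0] by (simp add: s load)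
  next
    assume "holds (LessReg 6 0) (step (SetConst 5 1) s)"
    then have "0 < n" by (simp add: s load)
    then have "l \<le> N" using \<open>l \<le> N \<or> n = 0\<close> by simp
    have "step (SetConst 5 1) s = s\<lparr>reg := (load [n, m, l])(5 := 1)\<rparr>"
      by (simp add: s)
    then show "runs sz M (While (LessReg 6 2) (Seq (Instr (AddReg 3 3 0)) (Instr (SubReg 2 2 5))))
        (step (SetConst 5 1) s) (1 + 3 * N)
        (\<lambda>s'. s' = s\<lparr>reg := (load [n, m])(3 := n * l, 5 := 1)\<rparr>)"
      using runs_weaken[OF loop[OF \<open>0 < n\<close>], of "1 + 3 * N"] \<open>l \<le> N\<close> by simp
  next
    assume "\<not> holds (LessReg 6 0) (step (SetConst 5 1) s)"
    then have "n = 0" by (simp add: s load)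
    then have "runs sz M (Instr (SetConst 2 0)) (step (SetConst 5 1) s) 1
        (\<lambda>s'. s' = s\<lparr>reg := (load [n, m])(3 := n * l, 5 := 1)\<rparr>)"
      using sz[of 0] empty by (intro runs_Instr) (simp_all add: s)
    then show "runs sz M (Instr (SetConst 2 0)) (step (SetConst 5 1) s) (1 + 3 * N)
        (\<lambda>s'. s' = s\<lparr>reg := (load [n, m])(3 := n * l, 5 := 1)\<rparr>)"
      by (rule runs_weaken) auto
  qed
  then show ?thesis by (rule runs_weaken) auto
qed

lemma runs_merge_cells:
  assumes sz: "\<And>k. k \<le> N \<Longrightarrow> sz (real k) \<le> M" "\<And>k. sz (rmem s k) \<le> M"
    and N: "1 \<le> N" "n * l \<le> N" and "1 \<le> l"
    and s: "reg s = (load [n, m])(3 := n * l, 5 := 1)"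
    and cm: "column_maxima n c (rmem s)" and zero: "\<And>k. n * l \<le> k \<Longrightarrow> rmem s k = 0"
  shows "runs sz M merge_cells s (1 + 6 * N)
    (\<lambda>s'. \<exists>p q. s' = s\<lparr>reg := (load [n, m])(3 := p, 4 := q, 5 := 1),
       rmem := (\<lambda>k. if k < n then c k else 0)\<rparr>)"
proof -
  \<comment> \<open>All cells from the pointer \<open>p\<close> on are erased, and the remaining
    ones still have the column maxima \<open>c\<close>. The content \<open>q\<close> of register 4
    is left open, as each round recomputes it before use.\<close>
  define I where "I s' \<longleftrightarrow> (\<exists>p q v.
      s' = s\<lparr>reg := (load [n, m])(3 := p, 4 := q, 5 := 1), rmem := v\<rparr> \<and>
      n \<le> p \<and> p \<le> N \<and> (\<forall>k. sz (v k) \<le> M) \<and> column_maxima n c v \<and> (\<forall>k\<ge>p. v k = 0))"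
    for s'
  have load: "load [n, m] 0 = n" "load [n, m] 6 = 0"
    by (simp_all add: load_def)
  have "n \<le> n * l" using \<open>1 \<le> l\<close> by simp
  then have "n \<le> N" using N(2) by (rule order_trans)
  have "I s"
    unfolding I_def
    by (intro exI[of _ "n * l"] exI[of _ 0] exI[of _ "rmem s"] conjI)
      (use \<open>n \<le> n * l\<close> N sz(2) cm zero s in \<open>auto simp: fun_eq_iff load_def intro!: state.equality\<close>)
  \<comment> \<open>A round costs 6 units: the loop test, two subtractions, two units for the
    conditional, and the erasure. The distance from the pointer to the end of the first row counts
    the rounds.\<close>
  have "runs sz M merge_cells s (1 + (reg s 3 - n) * (1 + (1 + (1 + ((1 + 1) + 1)))))
      (\<lambda>s'. I s' \<and> \<not> holds (LessReg 0 3) s')"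
    unfolding merge_cells_def
  proof (rule runs_While)
    show "I s" by fact
  next
    fix s' assume "I s'"
    then show "\<forall>x\<in>set (test_touched (LessReg 0 3) s'). sz x \<le> M"
      using sz(1) \<open>n \<le> N\<close> by (auto simp: I_def load)
  next
    fix s' assume "I s'" "holds (LessReg 0 3) s'"
    then obtain p q v
      where s': "s' = s\<lparr>reg := (load [n, m])(3 := p, 4 := q, 5 := 1), rmem := v\<rparr>"
        and p: "n < p" "p \<le> N" and v: "\<And>k. sz (v k) \<le> M" "column_maxima n c v" "\<And>k. p \<le> k \<Longrightarrow> v k = 0"
      by (auto simp: I_def load)
    let ?p = "p - 1"
    let ?w = "v(?p - n := max (v (?p - n)) (v ?p), ?p := 0)"
    define r where "r = (load [n, m])(3 := ?p, 4 := ?p - n, 5 := 1)"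
    define t where "t = s\<lparr>reg := r, rmem := v\<rparr>"
    define t' where "t' = s\<lparr>reg := r, rmem := v(?p - n := max (v (?p - n)) (v ?p))\<rparr>"
    have r: "r 3 = ?p" "r 4 = ?p - n" "r 6 = 0" "r(6 := 0) = r"
      by (auto simp: r_def load)
    have szs: "sz (real p) \<le> M" "sz (real ?p) \<le> M" "sz (real n) \<le> M" "sz (real (?p - n)) \<le> M"
        "sz (real 1) \<le> M" "sz (real 0) \<le> M"
      by (rule sz(1); use p \<open>n \<le> N\<close> N(1) in simp)+
    have "column_maxima n c ?w"
    \<comment> \<open>The invariant does not exclude empty rows. Then \<open>?p - n\<close> and
      \<open>?p\<close> coincide, but there are no columns and only non-negativity is left to
      show.\<close>
    proof (cases "n = 0")
      case True
      then show ?thesis using v(2) by (auto simp: column_maxima_def)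
    next
      case False
      then show ?thesis using p by (intro column_maxima_merge v) auto
    qed
    then have "I (s\<lparr>reg := r, rmem := ?w\<rparr>)"
      unfolding I_def r_def using p v szs(6)
      by (intro exI[of _ ?p] exI[of _ "?p - n"] exI[of _ ?w]) (auto simp: max_def)
    then have erase: "runs sz M (Instr (NatToReal 3 6)) t' 1 (\<lambda>u. I u \<and> reg u 3 - n < reg s' 3 - n)"
      using szs p by (intro runs_Instr) (auto simp: t'_def s' r)
    \<comment> \<open>A copy guarded by a comparison computes the maximum.\<close>
    have copy: "runs sz M (Cond (LessReal 4 3) (Instr (CopyReal 4 3)) (Instr (SetConst 6 0))) t
        (1 + 1) (\<lambda>u. u = t')"
      using szs v(1)
      by (intro runs_Cond runs_Instr)
        (auto simp: t_def t'_def r max_def simp del: of_nat_diff intro!: state.equality)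
    have step1: "step (SubReg 4 3 0) (step (SubReg 3 3 5) s') = t"
      by (auto simp: s' t_def r_def load fun_eq_iff)
    show "runs sz M
        (Seq (Instr (SubReg 3 3 5)) (Seq (Instr (SubReg 4 3 0))
          (Seq (Cond (LessReal 4 3) (Instr (CopyReal 4 3)) (Instr (SetConst 6 0)))
            (Instr (NatToReal 3 6))))) s' (1 + (1 + ((1 + 1) + 1)))
        (\<lambda>u. I u \<and> reg u 3 - n < reg s' 3 - n)"
    proof (intro runs_Seq runs_Instr, unfold step1)
      show "\<forall>x\<in>set (touched (SubReg 3 3 5) s'). sz x \<le> M"
        using szs by (auto simp: s' simp del: of_nat_diff)
      show "\<forall>x\<in>set (touched (SubReg 4 3 0) (step (SubReg 3 3 5) s')). sz x \<le> M"
        using szs by (auto simp: s' load simp del: of_nat_diff)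
      show "runs sz M (Cond (LessReal 4 3) (Instr (CopyReal 4 3)) (Instr (SetConst 6 0))) t
        (1 + 1) (\<lambda>u. runs sz M (Instr (NatToReal 3 6)) u 1
          (\<lambda>u. I u \<and> reg u 3 - n < reg s' 3 - n))"
        using copy by (rule runs_weaken) (use erase in auto)
    qed
  qed
  then show ?thesis
  proof (rule runs_weaken)
    have "reg s 3 - n \<le> N" using s N by simp
    then show "1 + (reg s 3 - n) * (1 + (1 + (1 + ((1 + 1) + 1)))) \<le> 1 + 6 * N" by simp
  next
    fix s' assume "I s' \<and> \<not> holds (LessReg 0 3) s'"
    then obtain q v
      where s': "s' = s\<lparr>reg := (load [n, m])(3 := n, 4 := q, 5 := 1), rmem := v\<rparr>"
        and v: "column_maxima n c v" "\<And>k. n \<le> k \<Longrightarrow> v k = 0"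
      by (fastforce simp: I_def load)
    have "v = (\<lambda>k. if k < n then c k else 0)"
      using column_maxima_first_row[OF v] v(2) by auto
    then show "\<exists>p q. s' = s\<lparr>reg := (load [n, m])(3 := p, 4 := q, 5 := 1),
       rmem := (\<lambda>k. if k < n then c k else 0)\<rparr>"
      using s' by blast
  qed
qed

text \<open>The budget adds \<open>3 + 3 * N\<close>, \<open>1 + 6 * N\<close> and 3 for the three
  pieces. The final state is given exactly, so that the next program can start from it.\<close>

lemma runs_row_maximum:
  assumes sz: "\<And>k. k \<le> N \<Longrightarrow> sz (real k) \<le> M" "\<And>k. sz (rmem s k) \<le> M"
    and N: "1 \<le> N" "n * l \<le> N" and "1 \<le> l"
    and s: "reg s = load [n, m, l]"
    and cm: "column_maxima n c (rmem s)" and zero: "\<And>k. n * l \<le> k \<Longrightarrow> rmem s k = 0"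
  shows "runs sz M row_maximum s (7 + 9 * N)
    (\<lambda>s'. s' = s\<lparr>reg := load [n, m], rmem := (\<lambda>k. if k < n then c k else 0)\<rparr>)"
proof -
  let ?end = "s\<lparr>reg := load [n, m], rmem := (\<lambda>k. if k < n then c k else 0)\<rparr>"
  have clear: "runs sz M clear_registers
      (s\<lparr>reg := (load [n, m])(3 := p, 4 := q, 5 := 1), rmem := (\<lambda>k. if k < n then c k else 0)\<rparr>)
      (1 + (1 + 1)) (\<lambda>s'. s' = ?end)" for p q
    unfolding clear_registers_def using sz(1)[of 0]
    by (intro runs_Seq runs_Instr) (auto simp: load_def fun_eq_iff intro!: state.equality)
  have "runs sz M merge_cells (s\<lparr>reg := (load [n, m])(3 := n * l, 5 := 1)\<rparr>) (1 + 6 * N)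
      (\<lambda>s'. runs sz M clear_registers s' (1 + (1 + 1)) (\<lambda>s'. s' = ?end))"
    by (rule runs_weaken[OF runs_merge_cells[where l = l and c = c and N = N]])
      (use assms clear in auto)
  then have "runs sz M (Seq merge_cells clear_registers)
      (s\<lparr>reg := (load [n, m])(3 := n * l, 5 := 1)\<rparr>) (1 + 6 * N + (1 + (1 + 1))) (\<lambda>s'. s' = ?end)"
    by (rule runs_Seq)
  then have "runs sz M last_row_end s (3 + 3 * N) (\<lambda>s'. runs sz M (Seq merge_cells clear_registers)
      s' (1 + 6 * N + (1 + (1 + 1))) (\<lambda>s'. s' = ?end))"
  proof (intro runs_weaken[OF runs_last_row_end[where l = l and N = N and s = s]])
    fix s' assume "s' = s\<lparr>reg := (load [n, m])(3 := n * l, 5 := 1)\<rparr>"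
    with \<open>runs sz M (Seq _ _) _ _ _\<close> show "runs sz M (Seq merge_cells clear_registers) s'
        (1 + 6 * N + (1 + (1 + 1))) (\<lambda>s'. s' = ?end)"
      by (simp only:)
  qed (use assms in simp_all)
  then have "runs sz M row_maximum s (3 + 3 * N + (1 + 6 * N + (1 + (1 + 1)))) (\<lambda>s'. s' = ?end)"
    unfolding row_maximum_def by (rule runs_Seq)
  then show ?thesis by (rule runs_weaken) auto
qed


section \<open>Sizes\<close>

text \<open>A crude linear bound is enough, as every register value charged to
  \<open>row_maximum\<close> is at most the input size. The denominator 1 contributes the extra
  unit.\<close>

lemma bit_size_nat: "bit_size (real k) \<le> k + 1"
proof -
  have "inv real_of_rat (real k) = rat_of_int (int k)"
    by (rule inv_f_eq) (auto simp: inj_def)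
  then have "quotient_of (inv real_of_rat (real k)) = (int k, 1)"
    using quotient_of_int[of "int k"] by (simp add: Rat.of_int_def)
  moreover have "floorlog 2 k \<le> k"
    by (rule floorlog_leI) auto
  moreover have "floorlog 2 1 \<le> 1"
    by (rule floorlog_leI) auto
  ultimately show ?thesis by (simp add: bit_size_def)
qed

lemma cost_models_sz_nat:
  "(D, sz) \<in> cost_models \<Longrightarrow> sz (real k) \<le> k + 1"
  using bit_size_nat by (auto simp: cost_models_def)

text \<open>The coefficients are natural numbers. This carries the time bound of the given algorithm
  from the smaller linear input over to the robust input.\<close>

lemma poly_nat_mono:
  fixes b :: "nat poly"
  shows "x \<le> y \<Longrightarrow> poly b x \<le> poly b y"
  by (induction b) (auto intro: mult_le_mono add_mono)

lemma concat_rows_nth: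
  assumes "k < length xs * l"
  shows "concat (map (\<lambda>i. map (g i) xs) [a..<a + l]) ! k = g (a + k div length xs) (xs ! (k mod length xs))"
  using assms
proof (induction l)
  case (Suc l)
  have len: "length (concat (map (\<lambda>i. map (g i) xs) [a..<a + l])) = length xs * l"
    by (simp add: length_concat comp_def sum_list_triv)
  show ?case
  proof (cases "k < length xs * l")
    case True
    then show ?thesis using Suc.IH len by (simp add: nth_append)
  next
    case False
    define d where "d = k - length xs * l"
    have "k = length xs * l + d" "d < length xs"
      using False Suc.prems by (auto simp: d_def)
    moreover from this have "xs \<noteq> []" by auto
    ultimately show ?thesis using len by (simp add: nth_append)
  qed
qed simp

lemma sum_list_concat_rows:
  fixes h :: "'a \<Rightarrow> nat"
  shows "(\<Sum>y\<leftarrow>concat (map (\<lambda>i. map (g i) xs) is). h y) = (\<Sum>x\<leftarrow>xs. \<Sum>i\<leftarrow>is. h (g i x))"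
  by (induction "is") (simp_all add: sum_list_addf comp_def)


section \<open>The reduction\<close>

text \<open>The linear cost function with these weights is \<open>F_hat l f\<close>.\<close>

definition max_cost :: "nat \<Rightarrow> (nat \<Rightarrow> 'v set \<Rightarrow> real) \<Rightarrow> 'v \<Rightarrow> real" where
  "max_cost l f j = (MAX i\<in>{1..l}. f i {j})"

text \<open>The maximum is itself an input number. Hence on the ground set it inherits membership in
  \<open>D\<close> and non-negativity, and its size is already counted in the robust input.\<close>

lemma max_cost_attained:
  assumes "1 \<le> l"
  obtains i where "i \<in> {1..l}" "max_cost l f j = f i {j}"
proof -
  have "max_cost l f j \<in> (\<lambda>i. f i {j}) ` {1..l}"
    unfolding max_cost_def using assms by (intro Max_in) auto
  then show ?thesis using that by blast
qed

lemma max_cost_instance: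
  assumes "(x, l, f) \<in> insts (robust_min D K)"
  shows "(x, max_cost l f) \<in> insts (linear_min D K)"
proof -
  have "1 \<le> l" using assms by (simp add: robust_min_def)
  have "max_cost l f j \<in> D \<and> 0 \<le> max_cost l f j" if "j \<in> set (elems K x)" for j
  proof -
    obtain i where "i \<in> {1..l}" "max_cost l f j = f i {j}"
      using max_cost_attained[OF \<open>1 \<le> l\<close>] .
    then show ?thesis using assms that by (simp add: robust_min_def)
  qed
  then show ?thesis using assms by (auto simp: robust_min_def linear_min_def)
qed

text \<open>Regroup the real inputs by columns: in each column, the entry attaining the maximum
  alone pays for the new cost.\<close>

lemma input_size_max_cost_le:
  assumes "1 \<le> l"
  shows "input_size sz (linear_min D K) (x, max_cost l f) \<le> input_size sz (robust_min D K) (x, l, f)"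
proof -
  have "1 + sz (max_cost l f j) \<le> (\<Sum>i\<leftarrow>[1..<Suc l]. 1 + sz (f i {j}))" for j
  proof -
    obtain i where "i \<in> {1..l}" "max_cost l f j = f i {j}"
      using max_cost_attained[OF assms] .
    then show ?thesis
      using member_le_sum_list[of "1 + sz (f i {j})" "map (\<lambda>i. 1 + sz (f i {j})) [1..<Suc l]"]
      by (auto simp del: upt_Suc)
  qed
  then have "(\<Sum>y\<leftarrow>map (max_cost l f) (elems K x). 1 + sz y) \<le>
      (\<Sum>y\<leftarrow>concat (map (\<lambda>i. map (\<lambda>j. f i {j}) (elems K x)) [1..<Suc l]). 1 + sz y)"
    unfolding sum_list_concat_rows map_map comp_def by (intro sum_list_mono)
  then show ?thesis
    by (simp add: input_size_def linear_min_def robust_min_def comp_def del: upt_Suc)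
qed

lemma column_maxima_robust_input:
  assumes inst: "(x, l, f) \<in> insts (robust_min D K)"
  shows "column_maxima (length (elems K x)) (\<lambda>k. max_cost l f (elems K x ! k))
    (load (in_reals (robust_min D K) (x, l, f)))" (is "column_maxima ?n ?c ?v")
proof -
  have "1 \<le> l" using inst by (simp add: robust_min_def)
  have len: "length (in_reals (robust_min D K) (x, l, f)) = ?n * l"
    by (simp add: robust_min_def length_concat comp_def sum_list_triv del: upt_Suc)
  have v: "?v k = f (1 + k div ?n) {elems K x ! (k mod ?n)}" if "k < ?n * l" for k
    using that concat_rows_nth[OF that, of "\<lambda>i j. f i {j}" 1] len
    by (simp add: load_def robust_min_def del: upt_Suc)
  have v0: "?v k = 0" if "\<not> k < ?n * l" for k
    using that len by (simp add: load_def)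
  have nonneg: "0 \<le> f i {elems K x ! j}" if "i \<in> {1..l}" "j < ?n" for i j
    using inst that by (auto simp: robust_min_def)
  have le: "f i {elems K x ! j} \<le> ?c j" if "i \<in> {1..l}" for i j
    unfolding max_cost_def using that by (intro Max_ge) auto
  have row: "1 + k div ?n \<in> {1..l}" "k mod ?n < ?n" if "k < ?n * l" for k
  proof -
    have "0 < ?n" using that by (cases ?n) auto
    then show "1 + k div ?n \<in> {1..l}" "k mod ?n < ?n"
      using that by (auto simp: Suc_le_eq less_mult_imp_div_less mult.commute)
  qed
  show ?thesis
    unfolding column_maxima_def
  proof (intro conjI allI impI)
    fix k show "0 \<le> ?v k"
      using v[of k] v0[of k] row[of k] nonneg by (cases "k < ?n * l") auto
  next
    fix j k assume j: "j < ?n" and k: "k mod ?n = j"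
    \<comment> \<open>Needed for the cells behind the input, which read as 0.\<close>
    have "0 \<le> ?c j"
      using nonneg[of 1 j] le[of 1 j] j \<open>1 \<le> l\<close> by auto
    then show "?v k \<le> ?c j"
      using v[of k] v0[of k] row[of k] le k by (cases "k < ?n * l") auto
  next
    fix j assume j: "j < ?n"
    obtain i where i: "i \<in> {1..l}" "?c j = f i {elems K x ! j}"
      using max_cost_attained[OF \<open>1 \<le> l\<close>] .
    \<comment> \<open>Rows are numbered from 1, so row \<open>i\<close> starts at cell
      \<open>(i - 1) * ?n\<close>.\<close>
    define k where "k = (i - 1) * ?n + j"
    have "k < (i - 1) * ?n + ?n" using j by (simp add: k_def)
    also have "\<dots> = i * ?n" using i(1) by (cases i) auto
    also have "\<dots> \<le> ?n * l" using i(1) by (simp add: mult.commute)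
    finally have "k < ?n * l" .
    moreover have "k div ?n = i - 1"
      unfolding k_def using j by (intro div_nat_eqI) (simp_all add: mult.commute)
    moreover have "k mod ?n = j"
      unfolding k_def using j by simp
    ultimately have "?v k = ?c j" using v[of k] i by simp
    then show "\<exists>k. k mod ?n = j \<and> ?v k = ?c j"
      using \<open>k mod ?n = j\<close> by blast
  qed
qed

text \<open>The size bound \<open>N + 1\<close> fits both cost models: naturals up to
  \<open>N\<close> have size at most \<open>N + 1\<close>, and the size of every input real is part
  of \<open>N\<close>.\<close>

lemma runs_row_maximum_init:
  assumes "(D, sz) \<in> cost_models" and inst: "(x, l, f) \<in> insts (robust_min D K)"
    and N: "N = input_size sz (robust_min D K) (x, l, f)"
  shows "runs sz (N + 1) row_maximum (init (robust_min D K) (x, l, f)) (7 + 9 * N)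
    (\<lambda>s. s = init (linear_min D K) (x, max_cost l f))"
proof -
  let ?P = "robust_min D K" and ?n = "length (elems K x)"
  let ?s = "init ?P (x, l, f)"
  let ?rs = "in_reals ?P (x, l, f)"
  have "1 \<le> l" using inst by (simp add: robust_min_def)
  have len: "length ?rs = ?n * l"
    by (simp add: robust_min_def length_concat comp_def sum_list_triv del: upt_Suc)
  have sum: "(\<Sum>y\<leftarrow>?rs. 1 + sz y) \<le> N"
    by (simp add: N input_size_def)
  \<comment> \<open>Every input real counts at least one unit, even when \<open>sz\<close> is
    constantly 0.\<close>
  have "?n * l \<le> N"
    using sum_list_mono[of ?rs "\<lambda>_. 1" "\<lambda>y. 1 + sz y"] sum len by (simp add: sum_list_triv)
  have "1 \<le> N" by (simp add: N input_size_def robust_min_def)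
  have sz_nat: "sz (real k) \<le> N + 1" if "k \<le> N" for k
    using cost_models_sz_nat[OF assms(1), of k] that by simp
  have sz_real: "sz (load ?rs k) \<le> N + 1" for k
  proof (cases "k < length ?rs")
    case True
    then have "1 + sz (?rs ! k) \<le> (\<Sum>y\<leftarrow>?rs. 1 + sz y)"
      by (intro member_le_sum_list) auto
    then show ?thesis using True sum by (simp add: load_def)
  next
    case False
    then show ?thesis using sz_nat[of 0] by (simp add: load_def)
  qed
  have "runs sz (N + 1) row_maximum ?s (7 + 9 * N)
    (\<lambda>s. s = ?s\<lparr>reg := load [?n, length (code K x)],
       rmem := (\<lambda>k. if k < ?n then max_cost l f (elems K x ! k) else 0)\<rparr>)"
  proof (rule runs_row_maximum)
    show "reg ?s = load [?n, length (code K x), l]"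
      by (simp add: init_def robust_min_def)
    show "column_maxima ?n (\<lambda>k. max_cost l f (elems K x ! k)) (rmem ?s)"
      using column_maxima_robust_input[OF inst] by (simp add: init_def)
    show "rmem ?s k = 0" if "?n * l \<le> k" for k
      using that len by (simp add: init_def load_def)
  qed (use sz_nat sz_real \<open>1 \<le> N\<close> \<open>?n * l \<le> N\<close> \<open>1 \<le> l\<close> in \<open>auto simp: init_def\<close>)
  \<comment> \<open>The memory of natural numbers is untouched and holds \<open>code K x\<close> in
    both problems.\<close>
  then show ?thesis
    by (rule runs_weaken)
      (auto simp: init_def robust_min_def linear_min_def load_def fun_eq_iff)
qed

text \<open>By determinism, the intermediate state of any run of \<open>Seq p q\<close> must be
  \<open>s1\<close>. This is needed because the approximation guarantee speaks of all halting
  runs.\<close>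

lemma exec_Seq_after:
  assumes "exec sz (Seq p q) s t s'" and "exec sz p s t1 s1"
  shows "\<exists>u. exec sz q s1 u s'"
  using assms(1) exec_deterministic[OF assms(2)] by (cases rule: exec.cases) blast

lemma approximation_robust_min:
  assumes "(D, sz) \<in> cost_models" and "valid_feasibility K" and "\<beta> \<ge> 1"
    and A: "approximation_algorithm sz (linear_min D K) (\<lambda>_. \<beta>) A"
  shows "approximation_algorithm sz (robust_min D K) (\<lambda>(x, l, f). real l * \<beta>) (Seq row_maximum A)"
proof -
  let ?L = "linear_min D K" and ?R = "robust_min D K"
  have "polynomial_time sz ?L A"
    and out: "\<forall>p\<in>insts ?L. \<forall>t s. exec sz A (init ?L p) t s \<longrightarrow>
        output_set ?L p s \<in> feas ?L p \<and>
        objective ?L p (output_set ?L p s) \<le> \<beta> * Min (objective ?L p ` feas ?L p)"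
    using A unfolding approximation_algorithm_def by (rule conjunct1, rule conjunct2)
  then obtain b where b: "\<forall>p\<in>insts ?L. \<exists>t s. exec sz A (init ?L p) t s \<and> t \<le> poly b (input_size sz ?L p)"
    unfolding polynomial_time_def by (elim exE)
  \<comment> \<open>For input size \<open>N\<close>, \<open>row_maximum\<close> takes at most
    \<open>7 + 9 * N\<close> units of length \<open>1 + 6 * (N + 1) = 7 + 6 * N\<close>; the summand
    \<open>b\<close> pays for the given algorithm.\<close>
  define b' where "b' = [:7, 9:] * [:7, 6:] + b"
  have row: "\<exists>t. exec sz row_maximum (init ?R (x, l, f)) t (init ?L (x, max_cost l f)) \<and>
      t \<le> poly ([:7, 9:] * [:7, 6:]) (input_size sz ?R (x, l, f))"
    if "(x, l, f) \<in> insts ?R" for x l f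
    using runs_row_maximum_init[OF assms(1) that refl]
    by (simp add: runs_def algebra_simps)
  have "\<exists>t s. exec sz (Seq row_maximum A) (init ?R p) t s \<and> t \<le> poly b' (input_size sz ?R p)"
    if inst: "p \<in> insts ?R" for p
  proof -
    obtain x l f where p: "p = (x, l, f)" by (cases p)
    obtain t where t: "exec sz row_maximum (init ?R p) t (init ?L (x, max_cost l f))"
        "t \<le> poly ([:7, 9:] * [:7, 6:]) (input_size sz ?R p)"
      using row[OF inst[unfolded p]] unfolding p by blast
    obtain u s where u: "exec sz A (init ?L (x, max_cost l f)) u s"
        "u \<le> poly b (input_size sz ?L (x, max_cost l f))"
      using bspec[OF b max_cost_instance[OF inst[unfolded p]]] by blast
    have "1 \<le> l" using inst by (simp add: p robust_min_def)
    have "u \<le> poly b (input_size sz ?R p)"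
      using u(2) poly_nat_mono[OF input_size_max_cost_le[OF \<open>1 \<le> l\<close>]] unfolding p
      by (rule order_trans)
    then have "t + u \<le> poly b' (input_size sz ?R p)"
      using t(2) unfolding b'_def poly_add by (intro add_mono)
    then show ?thesis using exec.Seq[OF t(1) u(1)] by blast
  qed
  then have poly: "polynomial_time sz ?R (Seq row_maximum A)"
    unfolding polynomial_time_def by blast
  have "output_set ?R p s \<in> feas ?R p \<and>
      objective ?R p (output_set ?R p s) \<le>
        (case p of (x, l, f) \<Rightarrow> real l * \<beta>) * Min (objective ?R p ` feas ?R p)"
    if inst: "p \<in> insts ?R" and ex: "exec sz (Seq row_maximum A) (init ?R p) t s" for p t s
  proof -
    obtain x l f where p: "p = (x, l, f)" by (cases p)
    let ?c = "max_cost l f" and ?V = "set (elems K x)" and ?X = "output_set ?R p s"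
    have l: "1 \<le> l" and "x \<in> structs K"
      and f: "\<And>i. i \<in> {1..l} \<Longrightarrow> modular_on ?V (f i)"
        "\<And>i j. i \<in> {1..l} \<Longrightarrow> j \<in> ?V \<Longrightarrow> f i {j} \<ge> 0"
      using inst by (auto simp: p robust_min_def)
    then have fam: "family K x \<noteq> {}" "family K x \<subseteq> Pow ?V"
      using assms(2) by (auto simp: valid_feasibility_def)
    then have fin: "finite (family K x)" by (auto intro: finite_subset)
    obtain u where "exec sz A (init ?L (x, ?c)) u s"
      using exec_Seq_after[OF ex] row[OF inst[unfolded p]] unfolding p by blast
    then have "output_set ?L (x, ?c) s \<in> feas ?L (x, ?c) \<and>
        objective ?L (x, ?c) (output_set ?L (x, ?c) s) \<le>
          \<beta> * Min (objective ?L (x, ?c) ` feas ?L (x, ?c))"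
      using out max_cost_instance[OF inst[unfolded p]] by blast
    moreover have "objective ?L (x, ?c) = F_hat l f"
      by (simp add: linear_min_def F_hat_def max_cost_def fun_eq_iff)
    \<comment> \<open>Both problems read the same memory through the same enumeration of the ground
      set.\<close>
    moreover have "output_set ?L (x, ?c) s = ?X"
      by (simp add: output_set_def p linear_min_def robust_min_def)
    ultimately have X: "?X \<in> family K x" "F_hat l f ?X \<le> \<beta> * Min (F_hat l f ` family K x)"
      by (simp_all add: linear_min_def)
    \<comment> \<open>The chain of estimates ends at an optimum \<open>Y\<close> of the robust
      problem; for the linear problem it only has to be feasible.\<close>
    have "Min (F_max l f ` family K x) \<in> F_max l f ` family K x"
      using fin fam by (intro Min_in) auto
    then obtain Y where Y: "Y \<in> family K x" "Min (F_max l f ` family K x) = F_max l f Y"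
      by auto
    have "?X \<subseteq> ?V" "Y \<subseteq> ?V" using X(1) Y(1) fam(2) by auto
    note XF = F_max_F_hat_F_tilde[OF l f \<open>?X \<subseteq> ?V\<close>]
      and YF = F_max_F_hat_F_tilde[OF l f \<open>Y \<subseteq> ?V\<close>]
    have "F_max l f ?X \<le> F_hat l f ?X" using XF(1) by simp
    also have "\<dots> \<le> \<beta> * F_hat l f Y"
    proof (rule order_trans[OF X(2)])
      have "Min (F_hat l f ` family K x) \<le> F_hat l f Y" using Y(1) fin by simp
      then show "\<beta> * Min (F_hat l f ` family K x) \<le> \<beta> * F_hat l f Y"
        using \<open>\<beta> \<ge> 1\<close> by (intro mult_left_mono) auto
    qed
    also have "\<dots> \<le> \<beta> * (real l * F_max l f Y)"
      using YF(2) l \<open>\<beta> \<ge> 1\<close> by (intro mult_left_mono) (auto simp: field_simps)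
    finally show ?thesis
      using X(1) Y(2) by (simp add: p robust_min_def mult_ac)
  qed
  with poly show ?thesis unfolding approximation_algorithm_def by blast
qed

theorem lemma2:
  fixes V :: "'v set" and l :: nat and f :: "nat \<Rightarrow> 'v set \<Rightarrow> real"
    and K :: "('x, 'v) feasibility" and \<beta> :: real
  assumes "finite V" and "l \<ge> 1"
    and "\<And>i. i \<in> {1..l} \<Longrightarrow> modular_on V (f i)"
    and "\<And>i j. i \<in> {1..l} \<Longrightarrow> j \<in> V \<Longrightarrow> f i {j} \<ge> 0"
    and "valid_feasibility K" and "\<beta> \<ge> 1"
  shows "(\<forall>X\<subseteq>V.
            F_hat l f X \<ge> F_max l f X \<and> F_max l f X \<ge> 1 / real l * F_hat l f X \<and>
            F_tilde l f X \<le> F_max l f X \<and> F_max l f X \<le> real l * F_tilde l f X) \<and>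
         (\<forall>(D, sz)\<in>cost_models.
            (\<exists>A. approximation_algorithm sz (linear_min D K) (\<lambda>_. \<beta>) A) \<longrightarrow>
            (\<exists>B. approximation_algorithm sz (robust_min D K) (\<lambda>(x, m, g). real m * \<beta>) B))"
proof (intro conjI)
  have "F_hat l f X \<ge> F_max l f X \<and> F_max l f X \<ge> 1 / real l * F_hat l f X \<and>
      F_tilde l f X \<le> F_max l f X \<and> F_max l f X \<le> real l * F_tilde l f X" if "X \<subseteq> V" for X
    by (intro conjI F_max_F_hat_F_tilde[where f = f, OF assms(2-4) that])
  then show "\<forall>X\<subseteq>V. F_hat l f X \<ge> F_max l f X \<and> F_max l f X \<ge> 1 / real l * F_hat l f X \<and>
      F_tilde l f X \<le> F_max l f X \<and> F_max l f X \<le> real l * F_tilde l f X"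
    by simp
  show "\<forall>(D, sz)\<in>cost_models.
      (\<exists>A. approximation_algorithm sz (linear_min D K) (\<lambda>_. \<beta>) A) \<longrightarrow>
      (\<exists>B. approximation_algorithm sz (robust_min D K) (\<lambda>(x, m, g). real m * \<beta>) B)"
    using approximation_robust_min[OF _ assms(5,6)] by blast
qed

end
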